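(* Let $(\Omega,\mathcal{A},\mu)$ be a nonatomic semifinite measure space. Then the set $\left(\bigcap_{q>0}\mathcal{S}_{L_q}\right)\setminus\mathcal{S}_p$ is strongly $\mathfrak{c}$-algebrable. In particular, the sets $\mathcal{S}_m\setminus\mathcal{S}_p$, $\mathcal{S}_m\setminus\mathcal{S}_c$, $\mathcal{S}_m\setminus\mathcal{S}_{au}$ and $\mathcal{S}_m\setminus\mathcal{S}_u$ are strongly $\mathfrak{c}$-algebrable.
   Context: $(\Omega,\mathcal{A},\mu)$ is a positive measure space with $\mu(\Omega)>0$. It is semifinite if $\mu(A)=\sup\{\mu(B):B\in\mathcal{A},\,B\subset A,\,\mu(B)<\infty\}$ for each $A\in\mathcal{A}$. An atom is a set $A\in\mathcal{A}$ with $\mu(A)>0$ for which there do not exist $B,C\in\mathcal{A}$ with $B\cap C=\varnothing$, $B\cup C=A$, $\mu(B)>0$ and $\mu(C)>0$; the measure space is nonatomic if it has no atoms. $L_0$ is the real vector space of ($\mu$-a.e. equality classes of) measurable functions $f:\Omega\to\mathbb{R}$. $L_0^{\mathbb{N}}$ is the commutative real algebra of all sequences $(f_n)_{n\in\mathbb{N}}$ in $L_0$ with coordinatewise operations, in particular $(f_n)\cdot(g_n):=(f_ng_n)$. Subsets of $L_0^{\mathbb{N}}$: $\mathcal{S}_p$: sequences with $f_n\to0$ pointwise almost everywhere. $\mathcal{S}_u$: $f_n\to0$ uniformly almost everywhere (there is $Z\in\mathcal{A}$ with $\mu(Z)=0$ and $f_n\to0$ uniformly on $\Omega\setminus Z$).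 $\mathcal{S}_{au}$: $f_n\to0$ almost uniformly (for every $\varepsilon>0$ there is $Z_\varepsilon\in\mathcal{A}$ with $\mu(Z_\varepsilon)<\varepsilon$ and $f_n\to0$ uniformly on $\Omega\setminus Z_\varepsilon$). $\mathcal{S}_m$: $f_n\to0$ in measure ($\lim_n\mu(\{|f_n|>\varepsilon\})=0$ for every $\varepsilon>0$). $\mathcal{S}_{L_q}$ ($q\in(0,+\infty)$): $\lim_n\int_\Omega|f_n|^q\,d\mu=0$. $\mathcal{S}_c$: $f_n\to0$ completely ($\sum_{n=1}^\infty\mu(\{|f_n|>\varepsilon\})<\infty$ for every $\varepsilon>0$). $\mathfrak{c}$ is the cardinality of the continuum. A subset $A$ of a commutative algebra is strongly $\mathfrak{c}$-algebrable if there is a $\mathfrak{c}$-generated free algebra $M$ with $M\setminus\{0\}\subset A$; that is, there is a subset $B$ of the algebra of cardinality $\mathfrak{c}$ such that for any positive integer $N$, any nonzero real polynomial $P$ in $N$ variables without constant term and any distinct $x_1,\dots,x_N\in B$, one has $P(x_1,\dots,x_N)\in A\setminus\{0\}$. *)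

theory Defs
  imports
    "HOL-Analysis.Analysis"
    "HOL-Algebra.Module"
    "HOL-Library.Poly_Mapping"
    "HOL-Library.Equipollence"
begin

section \<open>Measure spaces\<close>

text \<open>The library locale \<open>semifinite_measure\<close> is not used: its condition is already met by
  the empty subset, so it holds for every measure.\<close>

definition semifinite :: "'a measure \<Rightarrow> bool" where
  "semifinite M \<longleftrightarrow>
     (\<forall>A\<in>sets M. emeasure M A = (SUP B\<in>{B \<in> sets M. B \<subseteq> A \<and> emeasure M B < \<infinity>}. emeasure M B))"

definition is_atom :: "'a measure \<Rightarrow> 'a set \<Rightarrow> bool" where
  "is_atom M A \<longleftrightarrow> A \<in> sets M \<and> emeasure M A > 0 \<and>
     \<not> (\<exists>B\<in>sets M. \<exists>C\<in>sets M. B \<inter> C = {} \<and> B \<union> C = A \<and> emeasure M B > 0 \<and> emeasure M C > 0)"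

definition nonatomic :: "'a measure \<Rightarrow> bool" where
  "nonatomic M \<longleftrightarrow> \<not> (\<exists>A. is_atom M A)"


section \<open>The algebra of sequences of classes of measurable functions\<close>

definition ae_rel :: "'a measure \<Rightarrow> (('a \<Rightarrow> real) \<times> ('a \<Rightarrow> real)) set" where
  "ae_rel M = {(f, g). f \<in> borel_measurable M \<and> g \<in> borel_measurable M \<and> (AE x in M. f x = g x)}"

definition ae_class :: "'a measure \<Rightarrow> ('a \<Rightarrow> real) \<Rightarrow> ('a \<Rightarrow> real) set" where
  "ae_class M f = ae_rel M `` {f}"

text \<open>The unions below are unions of equal sets, all of them equal to the class of the
  operation applied to representatives.\<close>

definition L0 :: "'a measure \<Rightarrow> (real, ('a \<Rightarrow> real) set) module" where
  "L0 M = \<lparr>carrier = borel_measurable M // ae_rel M,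
           monoid.mult = (\<lambda>F G. \<Union>f\<in>F. \<Union>g\<in>G. ae_class M (\<lambda>x. f x * g x)),
           one = ae_class M (\<lambda>x. 1),
           ring.zero = ae_class M (\<lambda>x. 0),
           add = (\<lambda>F G. \<Union>f\<in>F. \<Union>g\<in>G. ae_class M (\<lambda>x. f x + g x)),
           smult = (\<lambda>c F. \<Union>f\<in>F. ae_class M (\<lambda>x. c * f x))\<rparr>"

definition seq_algebra :: "('r, 'b) module \<Rightarrow> ('r, nat \<Rightarrow> 'b) module" where
  "seq_algebra A = \<lparr>carrier = {F. \<forall>n. F n \<in> carrier A},
           monoid.mult = (\<lambda>F G n. F n \<otimes>\<^bsub>A\<^esub> G n),
           one = (\<lambda>n. \<one>\<^bsub>A\<^esub>),
           ring.zero = (\<lambda>n. \<zero>\<^bsub>A\<^esub>),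
           add = (\<lambda>F G n. F n \<oplus>\<^bsub>A\<^esub> G n),
           smult = (\<lambda>c F n. c \<odot>\<^bsub>A\<^esub> F n)\<rparr>"

abbreviation L0_seq :: "'a measure \<Rightarrow> (real, nat \<Rightarrow> ('a \<Rightarrow> real) set) module" where
  "L0_seq M \<equiv> seq_algebra (L0 M)"


section \<open>Modes of convergence to zero\<close>

text \<open>Sequences of classes are described through representatives; the choice of the
  representatives does not matter, see the lemmas \<open>S_p_iff\<close> etc. below.\<close>

definition seq_class :: "'a measure \<Rightarrow> (nat \<Rightarrow> 'a \<Rightarrow> real) \<Rightarrow> nat \<Rightarrow> ('a \<Rightarrow> real) set" where
  "seq_class M f = (\<lambda>n. ae_class M (f n))"

definition S_p :: "'a measure \<Rightarrow> (nat \<Rightarrow> ('a \<Rightarrow> real) set) set" where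
  "S_p M = {seq_class M f | f. (\<forall>n. f n \<in> borel_measurable M) \<and>
     (AE x in M. (\<lambda>n. f n x) \<longlonglongrightarrow> 0)}"

definition S_u :: "'a measure \<Rightarrow> (nat \<Rightarrow> ('a \<Rightarrow> real) set) set" where
  "S_u M = {seq_class M f | f. (\<forall>n. f n \<in> borel_measurable M) \<and>
     (\<exists>Z\<in>sets M. emeasure M Z = 0 \<and> uniform_limit (space M - Z) f (\<lambda>x. 0) sequentially)}"

definition S_au :: "'a measure \<Rightarrow> (nat \<Rightarrow> ('a \<Rightarrow> real) set) set" where
  "S_au M = {seq_class M f | f. (\<forall>n. f n \<in> borel_measurable M) \<and>
     (\<forall>\<epsilon>::real. \<epsilon> > 0 \<longrightarrow> (\<exists>Z\<in>sets M. emeasure M Z < ennreal \<epsilon> \<and>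
        uniform_limit (space M - Z) f (\<lambda>x. 0) sequentially))}"

definition S_m :: "'a measure \<Rightarrow> (nat \<Rightarrow> ('a \<Rightarrow> real) set) set" where
  "S_m M = {seq_class M f | f. (\<forall>n. f n \<in> borel_measurable M) \<and>
     (\<forall>\<epsilon>::real. \<epsilon> > 0 \<longrightarrow> (\<lambda>n. emeasure M {x \<in> space M. \<bar>f n x\<bar> > \<epsilon>}) \<longlonglongrightarrow> 0)}"

definition S_L :: "'a measure \<Rightarrow> real \<Rightarrow> (nat \<Rightarrow> ('a \<Rightarrow> real) set) set" where
  "S_L M q = {seq_class M f | f. (\<forall>n. f n \<in> borel_measurable M) \<and>
     (\<lambda>n. \<integral>\<^sup>+ x. ennreal (\<bar>f n x\<bar> powr q) \<partial>M) \<longlonglongrightarrow> 0}"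

definition S_c :: "'a measure \<Rightarrow> (nat \<Rightarrow> ('a \<Rightarrow> real) set) set" where
  "S_c M = {seq_class M f | f. (\<forall>n. f n \<in> borel_measurable M) \<and>
     (\<forall>\<epsilon>::real. \<epsilon> > 0 \<longrightarrow> suminf (\<lambda>n. emeasure M {x \<in> space M. \<bar>f n x\<bar> > \<epsilon>}) < \<infinity>)}"


section \<open>Strong algebrability\<close>

text \<open>A real polynomial in variables indexed by \<open>nat\<close> is a finitely supported map from
  monomials (finitely supported exponent functions) to coefficients.\<close>

type_synonym real_mpoly = "(nat \<Rightarrow>\<^sub>0 nat) \<Rightarrow>\<^sub>0 real"

definition in_vars :: "nat \<Rightarrow> real_mpoly \<Rightarrow> bool" where
  "in_vars N P \<longleftrightarrow> (\<forall>m\<in>Poly_Mapping.keys P. Poly_Mapping.keys m \<subseteq> {..<N})"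

definition mpoly_eval :: "(real, 'b) module \<Rightarrow> real_mpoly \<Rightarrow> (nat \<Rightarrow> 'b) \<Rightarrow> 'b" where
  "mpoly_eval A P x = finsum A
     (\<lambda>m. Poly_Mapping.lookup P m \<odot>\<^bsub>A\<^esub>
        finprod A (\<lambda>i. x i [^]\<^bsub>A\<^esub> Poly_Mapping.lookup m i) (Poly_Mapping.keys m))
     (Poly_Mapping.keys P)"

definition strongly_c_algebrable :: "(real, 'b) module \<Rightarrow> 'b set \<Rightarrow> bool" where
  "strongly_c_algebrable A S \<longleftrightarrow>
     (\<exists>B. B \<subseteq> carrier A \<and> B \<approx> (UNIV :: real set) \<and>
        (\<forall>N P x. N > 0 \<and> P \<noteq> 0 \<and> in_vars N P \<and> Poly_Mapping.lookup P 0 = 0 \<and>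
             x ` {..<N} \<subseteq> B \<and> inj_on x {..<N} \<longrightarrow>
           mpoly_eval A P x \<in> S - {\<zero>\<^bsub>A\<^esub>}))"


section \<open>Well-definedness\<close>

lemma equiv_ae_rel: "equiv (borel_measurable M) (ae_rel M)"
  unfolding equiv_def
proof (intro conjI)
  show "ae_rel M \<subseteq> borel_measurable M \<times> borel_measurable M" by (auto simp: ae_rel_def)
  show "refl_on (borel_measurable M) (ae_rel M)" by (auto simp: ae_rel_def refl_on_def)
  show "sym (ae_rel M)"
    unfolding sym_def ae_rel_def by (simp add: eq_commute)
  show "trans (ae_rel M)"
  proof (rule transI)
    fix f g h assume a: "(f, g) \<in> ae_rel M" "(g, h) \<in> ae_rel M"
    then have "AE x in M. f x = g x" "AE x in M. g x = h x" by (auto simp: ae_rel_def)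
    then have "AE x in M. f x = h x" by eventually_elim simp
    with a show "(f, h) \<in> ae_rel M" by (auto simp: ae_rel_def)
  qed
qed

lemma ae_class_eq_iff:
  assumes "f \<in> borel_measurable M" "g \<in> borel_measurable M"
  shows "ae_class M f = ae_class M g \<longleftrightarrow> (AE x in M. f x = g x)"
  using eq_equiv_class_iff[OF equiv_ae_rel assms] assms by (simp add: ae_class_def ae_rel_def)

lemma ae_class_in_carrier: "f \<in> borel_measurable M \<Longrightarrow> ae_class M f \<in> carrier (L0 M)"
  by (simp add: L0_def ae_class_def quotientI)

lemma L0_carrierE:
  assumes "F \<in> carrier (L0 M)"
  obtains f where "f \<in> borel_measurable M" "F = ae_class M f"
  using assms unfolding L0_def ae_class_def by (auto elim: quotientE)

lemma ae_class_measurable: "f' \<in> ae_class M f \<Longrightarrow> f' \<in> borel_measurable M"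
  by (simp add: ae_class_def ae_rel_def)

lemma ae_class_UN:
  assumes f: "f \<in> borel_measurable M"
    and h: "\<And>f'. f' \<in> borel_measurable M \<Longrightarrow> AE x in M. f x = f' x \<Longrightarrow> h f' = h f"
  shows "(\<Union>f'\<in>ae_class M f. h f') = h f"
proof -
  have "ae_class M f \<noteq> {}" using f by (auto simp: ae_class_def ae_rel_def)
  then show ?thesis
    by (rule SUP_eq_const) (rule h, simp_all add: ae_class_def ae_rel_def)
qed

lemma L0_add_class:
  assumes [measurable]: "f \<in> borel_measurable M" "g \<in> borel_measurable M"
  shows "ae_class M f \<oplus>\<^bsub>L0 M\<^esub> ae_class M g = ae_class M (\<lambda>x. f x + g x)"
proof -
  have *: "ae_class M (\<lambda>x. f1 x + g1 x) = ae_class M (\<lambda>x. f2 x + g2 x)"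
    if [measurable]: "f1 \<in> borel_measurable M" "g1 \<in> borel_measurable M"
      "f2 \<in> borel_measurable M" "g2 \<in> borel_measurable M"
      and e: "AE x in M. f2 x = f1 x" "AE x in M. g2 x = g1 x" for f1 f2 g1 g2
  proof (subst ae_class_eq_iff)
    show "AE x in M. f1 x + g1 x = f2 x + g2 x" using e by eventually_elim simp
  qed simp_all
  have "(\<Union>g'\<in>ae_class M g. ae_class M (\<lambda>x. f' x + g' x)) = ae_class M (\<lambda>x. f' x + g x)"
    if "f' \<in> borel_measurable M" for f'
    using that assms by (intro ae_class_UN *) simp_all
  then have "(\<Union>f'\<in>ae_class M f. \<Union>g'\<in>ae_class M g. ae_class M (\<lambda>x. f' x + g' x)) =
      (\<Union>f'\<in>ae_class M f. ae_class M (\<lambda>x. f' x + g x))"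
    by (intro SUP_cong refl) (metis ae_class_measurable)
  also have "\<dots> = ae_class M (\<lambda>x. f x + g x)"
    using assms by (intro ae_class_UN *) simp_all
  finally show ?thesis by (simp add: L0_def)
qed

lemma L0_mult_class:
  assumes [measurable]: "f \<in> borel_measurable M" "g \<in> borel_measurable M"
  shows "ae_class M f \<otimes>\<^bsub>L0 M\<^esub> ae_class M g = ae_class M (\<lambda>x. f x * g x)"
proof -
  have *: "ae_class M (\<lambda>x. f1 x * g1 x) = ae_class M (\<lambda>x. f2 x * g2 x)"
    if [measurable]: "f1 \<in> borel_measurable M" "g1 \<in> borel_measurable M"
      "f2 \<in> borel_measurable M" "g2 \<in> borel_measurable M"
      and e: "AE x in M. f2 x = f1 x" "AE x in M. g2 x = g1 x" for f1 f2 g1 g2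
  proof (subst ae_class_eq_iff)
    show "AE x in M. f1 x * g1 x = f2 x * g2 x" using e by eventually_elim simp
  qed simp_all
  have "(\<Union>g'\<in>ae_class M g. ae_class M (\<lambda>x. f' x * g' x)) = ae_class M (\<lambda>x. f' x * g x)"
    if "f' \<in> borel_measurable M" for f'
    using that assms by (intro ae_class_UN *) simp_all
  then have "(\<Union>f'\<in>ae_class M f. \<Union>g'\<in>ae_class M g. ae_class M (\<lambda>x. f' x * g' x)) =
      (\<Union>f'\<in>ae_class M f. ae_class M (\<lambda>x. f' x * g x))"
    by (intro SUP_cong refl) (metis ae_class_measurable)
  also have "\<dots> = ae_class M (\<lambda>x. f x * g x)"
    using assms by (intro ae_class_UN *) simp_all
  finally show ?thesis by (simp add: L0_def)
qed

lemma L0_smult_class: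
  assumes [measurable]: "f \<in> borel_measurable M"
  shows "c \<odot>\<^bsub>L0 M\<^esub> ae_class M f = ae_class M (\<lambda>x. c * f x)"
proof -
  have "(\<Union>f'\<in>ae_class M f. ae_class M (\<lambda>x. c * f' x)) = ae_class M (\<lambda>x. c * f x)"
  proof (rule ae_class_UN[OF assms])
    fix f' assume [measurable]: "f' \<in> borel_measurable M" and e: "AE x in M. f x = f' x"
    have "AE x in M. c * f' x = c * f x" using e by eventually_elim simp
    then show "ae_class M (\<lambda>x. c * f' x) = ae_class M (\<lambda>x. c * f x)"
      by (subst ae_class_eq_iff) simp_all
  qed
  then show ?thesis by (simp add: L0_def)
qed

lemma L0_zero: "\<zero>\<^bsub>L0 M\<^esub> = ae_class M (\<lambda>x. 0)"
  and L0_one: "\<one>\<^bsub>L0 M\<^esub> = ae_class M (\<lambda>x. 1)"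
  by (simp_all add: L0_def)

definition real_ring :: "real ring" where
  "real_ring = \<lparr>carrier = UNIV, monoid.mult = (*), one = 1, ring.zero = 0, add = (+)\<rparr>"

lemma cring_real_ring: "cring real_ring"
proof (rule cringI)
  show "abelian_group real_ring"
  proof (rule abelian_groupI)
    fix x assume "x \<in> carrier real_ring"
    show "\<exists>y\<in>carrier real_ring. y \<oplus>\<^bsub>real_ring\<^esub> x = \<zero>\<^bsub>real_ring\<^esub>"
      by (intro bexI[of _ "- x"]) (simp_all add: real_ring_def)
  qed (simp_all add: real_ring_def)
  show "comm_monoid real_ring"
    by (rule comm_monoidI) (simp_all add: real_ring_def)
qed (simp_all add: real_ring_def algebra_simps)

lemma L0_algebra: "Module.algebra real_ring (L0 M)"
proof -
  note cls = L0_add_class L0_mult_class L0_smult_class L0_zero L0_one ae_class_in_carrier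
  have ab: "abelian_group (L0 M)"
  proof (rule abelian_groupI)
    fix F assume "F \<in> carrier (L0 M)"
    then obtain f where f: "f \<in> borel_measurable M" "F = ae_class M f" by (rule L0_carrierE)
    show "\<exists>G\<in>carrier (L0 M). G \<oplus>\<^bsub>L0 M\<^esub> F = \<zero>\<^bsub>L0 M\<^esub>"
      using f by (intro bexI[of _ "ae_class M (\<lambda>x. - f x)"]) (simp_all add: cls)
  qed (auto elim!: L0_carrierE simp: cls algebra_simps)
  have cm: "comm_monoid (L0 M)"
    by (rule comm_monoidI) (auto elim!: L0_carrierE simp: cls algebra_simps)
  have cr: "cring (L0 M)"
    by (rule cringI[OF ab cm]) (auto elim!: L0_carrierE simp: cls algebra_simps)
  show ?thesis
    by (rule algebraI[OF cring_real_ring cr])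
       (auto elim!: L0_carrierE simp: cls algebra_simps real_ring_def)
qed

lemma seq_algebra_algebra:
  assumes "Module.algebra R A"
  shows "Module.algebra R (seq_algebra A)"
proof -
  interpret A: Module.algebra R A by fact
  have ab: "abelian_group (seq_algebra A)"
  proof (rule abelian_groupI)
    fix F assume "F \<in> carrier (seq_algebra A)"
    then show "\<exists>G\<in>carrier (seq_algebra A). G \<oplus>\<^bsub>seq_algebra A\<^esub> F = \<zero>\<^bsub>seq_algebra A\<^esub>"
      by (intro bexI[of _ "\<lambda>n. \<ominus>\<^bsub>A\<^esub> F n"]) (auto simp: seq_algebra_def A.M.l_neg)
  qed (auto simp: seq_algebra_def A.M.a_assoc intro: A.M.a_comm)
  have cm: "comm_monoid (seq_algebra A)"
    by (rule comm_monoidI) (auto simp: seq_algebra_def A.m_assoc intro: A.m_comm)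
  have cr: "cring (seq_algebra A)"
    by (rule cringI[OF ab cm]) (auto simp: seq_algebra_def A.l_distr)
  show ?thesis
    by (rule algebraI[OF A.R_cring cr])
       (auto simp: seq_algebra_def A.smult_l_distr A.smult_r_distr A.smult_assoc1 A.smult_assoc2)
qed

lemma seq_class_eqD:
  assumes "seq_class M f = seq_class M g"
    and "\<And>n. f n \<in> borel_measurable M" "\<And>n. g n \<in> borel_measurable M"
  shows "AE x in M. \<forall>n. f n x = g n x"
proof -
  have "ae_class M (f n) = ae_class M (g n)" for n
    using fun_cong[OF assms(1)] by (simp add: seq_class_def)
  then show ?thesis using assms by (simp add: ae_class_eq_iff AE_all_countable)
qed

lemma seq_class_Collect_iff:
  assumes f: "\<And>n. f n \<in> borel_measurable M"
    and P: "\<And>g h. \<lbrakk>\<And>n. g n \<in> borel_measurable M; \<And>n. h n \<in> borel_measurable M;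
        AE x in M. \<forall>n. g n x = h n x; Q g\<rbrakk> \<Longrightarrow> Q h"
  shows "seq_class M f \<in> {seq_class M g | g. (\<forall>n. g n \<in> borel_measurable M) \<and> Q g} \<longleftrightarrow> Q f"
proof
  assume "seq_class M f \<in> {seq_class M g | g. (\<forall>n. g n \<in> borel_measurable M) \<and> Q g}"
  then obtain g where g: "\<And>n. g n \<in> borel_measurable M" "Q g" "seq_class M g = seq_class M f"
    by (smt (verit) mem_Collect_eq)
  show "Q f" using P[OF g(1) f seq_class_eqD[OF g(3) g(1) f] g(2)] .
qed (use f in auto)

lemma uniform_limit_ae_transfer:
  assumes ae: "AE x in M. \<forall>n. g n x = h n x"
    and Z: "Z \<in> sets M" "uniform_limit (space M - Z) g (\<lambda>x. 0) sequentially"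
  obtains Z' where "Z' \<in> sets M" "emeasure M Z' = emeasure M Z"
    "uniform_limit (space M - Z') h (\<lambda>x. 0) sequentially"
proof -
  from ae obtain N where N: "{x \<in> space M. \<not> (\<forall>n. g n x = h n x)} \<subseteq> N"
    "emeasure M N = 0" "N \<in> sets M" by (rule AE_E)
  have "uniform_limit (space M - (Z \<union> N)) g (\<lambda>x. 0) sequentially"
    using Z(2) by (rule uniform_limit_on_subset) auto
  then have "uniform_limit (space M - (Z \<union> N)) h (\<lambda>x. 0) sequentially"
    by (rule uniform_limit_cong'[THEN iffD1, rotated 2]) (use N(1) in auto)
  moreover have "emeasure M (Z \<union> N) = emeasure M Z"
    using N Z(1) by (intro emeasure_Un_null_set) (auto simp: null_sets_def)
  ultimately show ?thesis using that N(3) Z(1) by blast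
qed

lemma emeasure_ae_transfer:
  fixes g h :: "nat \<Rightarrow> 'a \<Rightarrow> real"
  assumes [measurable]: "\<And>n. g n \<in> borel_measurable M" "\<And>n. h n \<in> borel_measurable M"
    and ae: "AE x in M. \<forall>n. g n x = h n x"
  shows "emeasure M {x \<in> space M. \<bar>g n x\<bar> > \<epsilon>} = emeasure M {x \<in> space M. \<bar>h n x\<bar> > \<epsilon>}"
proof (rule emeasure_eq_AE)
  show "AE x in M. x \<in> {x \<in> space M. \<bar>g n x\<bar> > \<epsilon>} \<longleftrightarrow> x \<in> {x \<in> space M. \<bar>h n x\<bar> > \<epsilon>}"
    using ae by eventually_elim simp
qed measurable

context
  fixes M :: "'a measure" and f :: "nat \<Rightarrow> 'a \<Rightarrow> real"
  assumes f: "\<And>n. f n \<in> borel_measurable M"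
begin

lemma S_p_iff: "seq_class M f \<in> S_p M \<longleftrightarrow> (AE x in M. (\<lambda>n. f n x) \<longlonglongrightarrow> 0)"
  unfolding S_p_def
proof (rule seq_class_Collect_iff[OF f])
  fix g h :: "nat \<Rightarrow> 'a \<Rightarrow> real"
  assume "AE x in M. \<forall>n. g n x = h n x" "AE x in M. (\<lambda>n. g n x) \<longlonglongrightarrow> 0"
  then show "AE x in M. (\<lambda>n. h n x) \<longlonglongrightarrow> 0" by eventually_elim simp
qed

lemma S_u_iff: "seq_class M f \<in> S_u M \<longleftrightarrow>
  (\<exists>Z\<in>sets M. emeasure M Z = 0 \<and> uniform_limit (space M - Z) f (\<lambda>x. 0) sequentially)"
  unfolding S_u_def
  proof (rule seq_class_Collect_iff[OF f])
  fix g h :: "nat \<Rightarrow> 'a \<Rightarrow> real"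
  assume ae: "AE x in M. \<forall>n. g n x = h n x"
  assume "\<exists>Z\<in>sets M. emeasure M Z = 0 \<and> uniform_limit (space M - Z) g (\<lambda>x. 0) sequentially"
  then obtain Z where Z: "Z \<in> sets M" "emeasure M Z = 0"
    "uniform_limit (space M - Z) g (\<lambda>x. 0) sequentially" by blast
  from uniform_limit_ae_transfer[OF ae Z(1,3)] Z(2)
  show "\<exists>Z\<in>sets M. emeasure M Z = 0 \<and> uniform_limit (space M - Z) h (\<lambda>x. 0) sequentially"
    by metis
qed

lemma S_au_iff: "seq_class M f \<in> S_au M \<longleftrightarrow>
  (\<forall>\<epsilon>::real. \<epsilon> > 0 \<longrightarrow> (\<exists>Z\<in>sets M. emeasure M Z < ennreal \<epsilon> \<and>
     uniform_limit (space M - Z) f (\<lambda>x. 0) sequentially))"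
  unfolding S_au_def
  proof (rule seq_class_Collect_iff[OF f], intro allI impI)
  fix g h :: "nat \<Rightarrow> 'a \<Rightarrow> real" and \<epsilon> :: real
  assume ae: "AE x in M. \<forall>n. g n x = h n x" and "\<epsilon> > 0"
  assume "\<forall>\<epsilon>::real. \<epsilon> > 0 \<longrightarrow> (\<exists>Z\<in>sets M. emeasure M Z < ennreal \<epsilon> \<and>
     uniform_limit (space M - Z) g (\<lambda>x. 0) sequentially)"
  with \<open>\<epsilon> > 0\<close> obtain Z where Z: "Z \<in> sets M" "emeasure M Z < ennreal \<epsilon>"
    "uniform_limit (space M - Z) g (\<lambda>x. 0) sequentially" by blast
  from uniform_limit_ae_transfer[OF ae Z(1,3)] Z(2)
  show "\<exists>Z\<in>sets M. emeasure M Z < ennreal \<epsilon> \<and>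
     uniform_limit (space M - Z) h (\<lambda>x. 0) sequentially"
    by metis
qed

lemma S_m_iff: "seq_class M f \<in> S_m M \<longleftrightarrow>
  (\<forall>\<epsilon>::real. \<epsilon> > 0 \<longrightarrow> (\<lambda>n. emeasure M {x \<in> space M. \<bar>f n x\<bar> > \<epsilon>}) \<longlonglongrightarrow> 0)"
  unfolding S_m_def
proof (rule seq_class_Collect_iff[OF f])
  fix g h :: "nat \<Rightarrow> 'a \<Rightarrow> real"
  assume "\<And>n. g n \<in> borel_measurable M" "\<And>n. h n \<in> borel_measurable M"
    "AE x in M. \<forall>n. g n x = h n x"
  note eq = emeasure_ae_transfer[OF this]
  assume "\<forall>\<epsilon>::real. \<epsilon> > 0 \<longrightarrow>  (\<lambda>n. emeasure M {x \<in> space M. \<bar>g n x\<bar> > \<epsilon>}) \<longlonglongrightarrow> 0"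
  then show "\<forall>\<epsilon>::real. \<epsilon> > 0 \<longrightarrow>  (\<lambda>n. emeasure M {x \<in> space M. \<bar>h n x\<bar> > \<epsilon>}) \<longlonglongrightarrow> 0"
    unfolding eq .
qed

lemma S_L_iff: "seq_class M f \<in> S_L M q \<longleftrightarrow>
  (\<lambda>n. \<integral>\<^sup>+ x. ennreal (\<bar>f n x\<bar> powr q) \<partial>M) \<longlonglongrightarrow> 0"
  unfolding S_L_def
proof (rule seq_class_Collect_iff[OF f])
  fix g h :: "nat \<Rightarrow> 'a \<Rightarrow> real"
  assume ae: "AE x in M. \<forall>n. g n x = h n x"
    and g: "(\<lambda>n. \<integral>\<^sup>+ x. ennreal (\<bar>g n x\<bar> powr q) \<partial>M) \<longlonglongrightarrow> 0"
  have "(\<integral>\<^sup>+ x. ennreal (\<bar>g n x\<bar> powr q) \<partial>M) = (\<integral>\<^sup>+ x. ennreal (\<bar>h n x\<bar> powr q) \<partial>M)" for n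
    by (rule nn_integral_cong_AE) (use ae in eventually_elim, simp)
  with g show "(\<lambda>n. \<integral>\<^sup>+ x. ennreal (\<bar>h n x\<bar> powr q) \<partial>M) \<longlonglongrightarrow> 0" by simp
qed

lemma S_c_iff: "seq_class M f \<in> S_c M \<longleftrightarrow>
  (\<forall>\<epsilon>::real. \<epsilon> > 0 \<longrightarrow> suminf (\<lambda>n. emeasure M {x \<in> space M. \<bar>f n x\<bar> > \<epsilon>}) < \<infinity>)"
  unfolding S_c_def
proof (rule seq_class_Collect_iff[OF f])
  fix g h :: "nat \<Rightarrow> 'a \<Rightarrow> real"
  assume "\<And>n. g n \<in> borel_measurable M" "\<And>n. h n \<in> borel_measurable M"
    "AE x in M. \<forall>n. g n x = h n x"
  note eq = emeasure_ae_transfer[OF this]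
  assume "\<forall>\<epsilon>::real. \<epsilon> > 0 \<longrightarrow> suminf (\<lambda>n. emeasure M {x \<in> space M. \<bar>g n x\<bar> > \<epsilon>}) < \<infinity>"
  then show "\<forall>\<epsilon>::real. \<epsilon> > 0 \<longrightarrow> suminf (\<lambda>n. emeasure M {x \<in> space M. \<bar>h n x\<bar> > \<epsilon>}) < \<infinity>"
    unfolding eq .
qed

end

end

theory Submission
  imports Defs
begin

text \<open>
  Fix a set E of positive finite measure. For each k, E is a finite union of sets of measure at most
  exp (- k^2); enumerating the sets of all these covers gives sets A n of level k n, where k n tends
  to infinity and every point of E lies in infinitely many A n. The free generators are
  X \<alpha> = (exp (k n powr \<alpha>) * indicator (A n)) for 0 < \<alpha> < 1. A polynomial
  without constant term evaluates on them to p (k n) * indicator (A n), where p is a linear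
  combination of functions exp (\<Sum>i. m i * k powr \<alpha> i) with distinct, nonzero exponents.
  One of these exponents dominates all others, so \<bar>p k\<bar> tends to infinity and
  pointwise convergence fails on E; on the other hand \<bar>p k\<bar> \<le> C * exp (K * k),
  which exp (- k^2) beats in every L_q.
\<close>

section \<open>Typewriter sequences in nonatomic measure spaces\<close>

text \<open>Since \<open>A\<close> is not an atom, it splits into two pieces of positive measure,
  and the smaller piece has at most half of the measure.\<close>

lemma nonatomic_halve:
  assumes na: "nonatomic M" and A: "A \<in> fmeasurable M" "measure M A > 0"
  obtains B where "B \<in> fmeasurable M" "B \<subseteq> A" "measure M B > 0" "measure M B \<le> measure M A / 2"
proof -
  have "emeasure M A > 0"
    using A by (simp add: emeasure_eq_measure2)
  then obtain B C where BC: "B \<in> sets M" "C \<in> sets M" "B \<inter> C = {}" "B \<union> C = A"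
      "emeasure M B > 0" "emeasure M C > 0"
    using na A unfolding nonatomic_def is_atom_def by (metis fmeasurableD)
  have f: "B \<in> fmeasurable M" "C \<in> fmeasurable M"
    using BC(4) by (auto intro: fmeasurableI2[OF A(1)] BC(1,2))
  have "measure M A = measure M B + measure M C"
    using measure_Un2[OF f] BC(3,4) by (simp add: Diff_triv Int_commute)
  moreover have "measure M B > 0" "measure M C > 0"
    using f BC(5,6) by (auto simp: emeasure_eq_measure2)
  moreover have "B \<subseteq> A" "C \<subseteq> A" using BC(4) by auto
  ultimately show ?thesis
    using that[of B] that[of C] f by (cases "measure M B \<le> measure M C") auto
qed

text \<open>Halving \<open>n\<close> times leaves a set of positive measure at most
  \<open>measure M A / 2 ^ n\<close>, which drops below \<epsilon> for large
  \<open>n\<close>.\<close>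

lemma nonatomic_small_subset:
  assumes na: "nonatomic M" and A: "A \<in> fmeasurable M" "measure M A > 0" and e: "\<epsilon> > 0"
  obtains B where "B \<in> fmeasurable M" "B \<subseteq> A" "measure M B > 0" "measure M B \<le> \<epsilon>"
proof -
  have ex: "\<exists>B\<in>fmeasurable M. B \<subseteq> A \<and> measure M B > 0 \<and> measure M B \<le> measure M A / 2 ^ n" for n
  proof (induction n)
    case 0
    then show ?case using A by auto
  next
    case (Suc n)
    then obtain B where B: "B \<in> fmeasurable M" "B \<subseteq> A" "measure M B > 0"
        "measure M B \<le> measure M A / 2 ^ n"
      by blast
    obtain C where C: "C \<in> fmeasurable M" "C \<subseteq> B" "measure M C > 0" "measure M C \<le> measure M B / 2"
      using nonatomic_halve[OF na B(1,3)] .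
    have "measure M B / 2 \<le> measure M A / 2 ^ Suc n"
      using B(4) by (simp add: field_simps)
    then show ?case using B C by (intro bexI[of _ C]) auto
  qed
  obtain n where "measure M A / \<epsilon> < 2 ^ n"
    using real_arch_pow[of 2 "measure M A / \<epsilon>"] by auto
  then have "measure M A / 2 ^ n \<le> \<epsilon>"
    using e by (simp add: field_simps)
  with ex[of n] show ?thesis
    using that by (meson order_trans)
qed

text \<open>An exhaustion argument. Among countable unions of small subsets of \<open>E\<close> one
  attains the supremal measure; what it misses is null, since otherwise a further small subset could
  be added. Cutting this union off after finitely many members leaves a remainder that is itself
  small.\<close>

lemma nonatomic_finite_cover:
  assumes na: "nonatomic M" and E: "E \<in> fmeasurable M" and e: "\<epsilon> > 0"
  obtains F where "finite F" "F \<subseteq> fmeasurable M" "\<Union>F = E" "\<And>S. S \<in> F \<Longrightarrow> measure M S \<le> \<epsilon>"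
proof -
  define small where "small = {S \<in> fmeasurable M. S \<subseteq> E \<and> measure M S \<le> \<epsilon>}"
  define U where "U = {\<Union>F | F. countable F \<and> F \<subseteq> small}"
  have U_iff: "X \<in> U \<longleftrightarrow> (\<exists>F. X = \<Union>F \<and> countable F \<and> F \<subseteq> small)" for X
    unfolding U_def by simp
  have Uf: "X \<in> fmeasurable M \<and> X \<subseteq> E" if "X \<in> U" for X
  proof -
    have "\<exists>F. X = \<Union>F \<and> countable F \<and> F \<subseteq> small" using that by (simp only: U_iff)
    then obtain F where F: "X = \<Union>F" "countable F" "F \<subseteq> small" by (elim exE conjE)
    then have "X \<subseteq> E" by (auto simp: small_def)
    moreover have "X \<in> sets M"
      unfolding F(1) using F by (intro sets.countable_Union) (auto simp: small_def)
    ultimately show ?thesis using fmeasurableI2[OF E] by blast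
  qed
  have bound: "measure M X \<le> measure M E" if "X \<in> U" for X
    using Uf[OF that] E by (auto intro: measure_mono_fmeasurable)
  define s where "s = Sup (measure M ` U)"
  have bdd: "bdd_above (measure M ` U)"
    using bound by (auto simp: bdd_above_def)
  have le_s: "measure M X \<le> s" if "X \<in> U" for X
    unfolding s_def using that bdd by (auto intro: cSup_upper)
  have "\<Union>{} \<in> U"
    unfolding U_iff by (intro exI[of _ "{}"]) simp
  then have ne: "U \<noteq> {}" by (metis empty_iff)
  have "\<exists>X\<in>U. s - 1 / real (Suc n) < measure M X" for n
    using less_cSupD[of "measure M ` U" "s - 1 / real (Suc n)"] ne by (auto simp: s_def)
  then obtain X where X: "\<And>n. X n \<in> U" "\<And>n. s - 1 / real (Suc n) < measure M (X n)"
    by metis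
  then have "\<forall>n. \<exists>F. X n = \<Union>F \<and> countable F \<and> F \<subseteq> small"
    unfolding U_iff by simp
  then obtain F where F: "\<And>n. X n = \<Union>(F n)" "\<And>n. countable (F n)" "\<And>n. F n \<subseteq> small"
    by metis
  \<comment> \<open>Merging the families of a maximizing sequence gives one countable family whose
    union attains \<open>s\<close>. The empty set is inserted so that \<open>G\<close> can be
    enumerated even if all \<open>F n\<close> are empty.\<close>
  define G where "G = insert {} (\<Union>n. F n)"
  have G: "countable G" "G \<subseteq> small" "G \<noteq> {}"
  proof -
    have "{} \<in> small" using e by (simp add: small_def)
    then show "countable G" "G \<subseteq> small" "G \<noteq> {}"
      unfolding G_def using F(2,3) by (simp_all add: UN_subset_iff)
  qed
  have GU: "\<Union>G \<in> U" using G(1,2) U_iff by metis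
  have "s \<le> measure M (\<Union>G)"
  proof (rule field_le_epsilon)
    fix d :: real assume "d > 0"
    then obtain n where "1 / real (Suc n) < d" using nat_approx_posE by metis
    moreover have "measure M (X n) \<le> measure M (\<Union>G)"
    proof (rule measure_mono_fmeasurable)
      show "X n \<subseteq> \<Union>G" unfolding F(1) G_def by blast
      show "X n \<in> sets M" using Uf[OF X(1)] fmeasurableD by blast
      show "\<Union>G \<in> fmeasurable M" using Uf[OF GU] by blast
    qed
    ultimately show "s \<le> measure M (\<Union>G) + d" using X(2)[of n] by linarith
  qed
  have null: "measure M (E - \<Union>G) = 0"
  proof (rule ccontr)
    assume "measure M (E - \<Union>G) \<noteq> 0"
    then have "measure M (E - \<Union>G) > 0" by (simp add: zero_less_measure_iff)
    moreover have "E - \<Union>G \<in> fmeasurable M" using E Uf[OF GU] by (auto intro: fmeasurable_Diff)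
    ultimately obtain B where B: "B \<in> fmeasurable M" "B \<subseteq> E - \<Union>G" "measure M B > 0" "measure M B \<le> \<epsilon>"
      using nonatomic_small_subset[OF na _ _ e] by metis
    \<comment> \<open>\<open>B\<close> is small and disjoint from the union of \<open>G\<close>, so
      adjoining it would produce a member of \<open>U\<close> of measure greater than
      \<open>s\<close>.\<close>
    have "\<Union>(insert B G) \<in> U"
      unfolding U_iff
    proof (intro exI conjI)
      show "\<Union>(insert B G) = \<Union>(insert B G)" by (rule refl)
      show "countable (insert B G)" using G(1) by simp
      show "insert B G \<subseteq> small" using B G(2) by (auto simp: small_def)
    qed
    then have "measure M (B \<union> \<Union>G) \<le> s" using le_s by simp
    moreover have "measure M (B \<union> \<Union>G) = measure M B + measure M (\<Union>G)"
    proof -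
      have "\<Union>G - B = \<Union>G" using B(2) by auto
      then show ?thesis
        using measure_Un2[of B M "\<Union>G"] B(1) Uf[OF GU] by simp
    qed
    ultimately show False using B(3) \<open>s \<le> measure M (\<Union>G)\<close> by simp
  qed
  define S where "S = from_nat_into G"
  have S: "range S = G" using G by (simp add: S_def range_from_nat_into)
  \<comment> \<open>\<open>R n\<close> is what the first \<open>n\<close> members leave uncovered.
    These sets have finite measure and decrease to a null set, so some \<open>R n\<close> has
    measure below \<epsilon> and can complete the finite cover.\<close>
  define R where "R n = E - (\<Union>i<n. S i)" for n
  have Sf: "S i \<in> fmeasurable M" "S i \<subseteq> E" "measure M (S i) \<le> \<epsilon>" for i
    using S G(2) by (auto simp: small_def)
  have Rf: "R n \<in> fmeasurable M" for n
    unfolding R_def using Sf by (intro fmeasurable_Diff E) (auto intro: fmeasurableD)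
  have "(\<lambda>n. measure M (R n)) \<longlonglongrightarrow> measure M (\<Inter>n. R n)"
  proof (rule Lim_measure_decseq)
    show "range R \<subseteq> sets M" using Rf by (auto intro: fmeasurableD)
    show "decseq R" unfolding R_def by (intro decseq_SucI) (auto simp: lessThan_Suc)
    show "\<And>i. emeasure M (R i) \<noteq> \<infinity>" using fmeasurableD2[OF Rf] by simp
  qed
  moreover have "(\<Inter>n. R n) = E - \<Union>G"
    unfolding R_def S[symmetric] by auto
  ultimately have "(\<lambda>n. measure M (R n)) \<longlonglongrightarrow> 0" using null by simp
  then have "\<forall>\<^sub>F n in sequentially. measure M (R n) < \<epsilon>"
    using e by (rule order_tendstoD)
  then obtain n where n: "measure M (R n) < \<epsilon>" by (auto simp: eventually_sequentially)
  show ?thesis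
  proof (rule that[of "insert (R n) (S ` {..<n})"])
    show "\<Union>(insert (R n) (S ` {..<n})) = E" using Sf(2) by (auto simp: R_def)
    show "insert (R n) (S ` {..<n}) \<subseteq> fmeasurable M" using Sf(1) Rf by blast
    show "measure M T \<le> \<epsilon>" if "T \<in> insert (R n) (S ` {..<n})" for T
      using that n Sf(3) by (metis imageE insertE less_imp_le)
  qed simp
qed

text \<open>The abstract form of the typewriter sequence: finite covers of \<open>E\<close>, one for
  each level \<open>k\<close>, are listed one set at a time. A level uses up finitely many indices,
  and every point of \<open>E\<close> is met at every level.\<close>

lemma nonatomic_typewriter:
  assumes na: "nonatomic M" and E: "E \<in> fmeasurable M" "E \<noteq> {}" and e: "\<And>k. \<epsilon> k > 0"
  obtains A :: "nat \<Rightarrow> 'a set" and k :: "nat \<Rightarrow> nat"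
  where "\<And>n. A n \<in> fmeasurable M" "\<And>n. measure M (A n) \<le> \<epsilon> (k n)"
    "filterlim k at_top sequentially" "\<And>x. x \<in> E \<Longrightarrow> \<exists>\<^sub>F n in sequentially. x \<in> A n"
proof -
  have "\<exists>F. finite F \<and> F \<subseteq> fmeasurable M \<and> \<Union>F = E \<and> (\<forall>S\<in>F. measure M S \<le> \<epsilon> k)" for k
    using nonatomic_finite_cover[OF na E(1) e[of k]] by metis
  then obtain F where F: "\<And>k. finite (F k)" "\<And>k. F k \<subseteq> fmeasurable M" "\<And>k. \<Union>(F k) = E"
      "\<And>k S. S \<in> F k \<Longrightarrow> measure M S \<le> \<epsilon> k"
    by metis
  \<comment> \<open>Pairs of level and set are enumerated rather than sets, so that a set occurring
    in the covers of several levels is listed once for each of them.\<close>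
  define \<Sigma> where "\<Sigma> = Sigma (UNIV :: nat set) F"
  \<comment> \<open>As \<open>E\<close> is nonempty, no level is empty; hence \<Sigma> is infinite
    and its enumeration is a bijection from the naturals.\<close>
  have ne: "F k \<noteq> {}" for k using F(3)[of k] E(2) by auto
  have cnt: "countable \<Sigma>" unfolding \<Sigma>_def using F(1) by (auto intro: countable_finite)
  have "fst ` \<Sigma> = UNIV" using ne by (force simp: \<Sigma>_def image_iff)
  then have inf: "infinite \<Sigma>" using finite_imageI infinite_UNIV_nat by metis
  have bij: "bij_betw (from_nat_into \<Sigma>) UNIV \<Sigma>"
    using bij_betw_from_nat_into[OF cnt inf] .
  define k where "k n = fst (from_nat_into \<Sigma> n)" for n
  define A where "A n = snd (from_nat_into \<Sigma> n)" for n
  have AF: "A n \<in> F (k n)" for n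
    using bij_betwE[OF bij] unfolding A_def k_def \<Sigma>_def by (metis UNIV_I mem_Sigma_iff prod.collapse)
  have k_lim: "filterlim k at_top sequentially"
    unfolding filterlim_at_top
  proof
    fix K
    have "finite (Sigma {..K} F)" using F(1) by auto
    then have "finite (from_nat_into \<Sigma> -` Sigma {..K} F)"
      using bij by (intro finite_vimageI) (auto simp: bij_betw_def)
    moreover have "{n. \<not> K \<le> k n} \<subseteq> from_nat_into \<Sigma> -` Sigma {..K} F"
    proof
      fix n assume "n \<in> {n. \<not> K \<le> k n}"
      then show "n \<in> from_nat_into \<Sigma> -` Sigma {..K} F"
        using AF[of n] unfolding A_def k_def by (cases "from_nat_into \<Sigma> n") auto
    qed
    ultimately have "finite {n. \<not> K \<le> k n}" using finite_subset by blast
    then show "\<forall>\<^sub>F n in sequentially. K \<le> k n"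
      by (simp add: eventually_cofinite cofinite_eq_sequentially[symmetric])
  qed
  have "\<exists>\<^sub>F n in sequentially. x \<in> A n" if x: "x \<in> E" for x
  proof -
    \<comment> \<open>Every level \<open>j\<close> has a set containing \<open>x\<close>, so the
      indices \<open>n\<close> with \<open>x \<in> A n\<close> map onto all levels and must be
      infinite in number.\<close>
    have "UNIV \<subseteq> k ` {n. x \<in> A n}"
    proof
      fix j
      obtain S where S: "S \<in> F j" "x \<in> S" using F(3)[of j] x by blast
      then have "(j, S) \<in> \<Sigma>" by (simp add: \<Sigma>_def)
      then obtain n where "from_nat_into \<Sigma> n = (j, S)"
        using bij unfolding bij_betw_def by (metis imageE)
      with S have "j = k n" "x \<in> A n" by (simp_all add: k_def A_def)
      then show "j \<in> k ` {n. x \<in> A n}" by blast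
    qed
    then have "infinite {n. x \<in> A n}"
      using finite_surj infinite_UNIV_nat by blast
    then show ?thesis
      by (simp add: frequently_cofinite cofinite_eq_sequentially[symmetric])
  qed
  with AF F k_lim show ?thesis by (intro that[of A k]) blast+
qed

text \<open>Supplies the set of positive finite measure that carries the whole construction: a
  positive supremum has a positive competitor.\<close>

lemma semifinite_obtains:
  assumes "semifinite M" "A \<in> sets M" "emeasure M A > 0"
  obtains B where "B \<in> fmeasurable M" "B \<subseteq> A" "measure M B > 0"
proof -
  have "0 < (SUP B\<in>{B \<in> sets M. B \<subseteq> A \<and> emeasure M B < \<infinity>}. emeasure M B)"
    using assms by (metis semifinite_def)
  then obtain B where "B \<in> sets M" "B \<subseteq> A" "emeasure M B < \<infinity>" "emeasure M B > 0"
    by (auto simp: less_SUP_iff)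
  then show ?thesis
    using that[of B] by (auto simp: fmeasurable_def measure_def enn2real_positive_iff)
qed

section \<open>Growth of exponential sums and polynomials\<close>

text \<open>The largest exponent \<open>\<alpha> j\<close> with a nonzero coefficient wins: after
  division by \<open>k powr \<alpha> j\<close> the sum tends to \<open>d j\<close>, whose sign
  decides between the two infinite limits.\<close>

lemma powr_sum_divergent:
  fixes d \<alpha> :: "'i \<Rightarrow> real"
  assumes I: "finite I" and inj: "inj_on \<alpha> I" and pos: "\<And>i. i \<in> I \<Longrightarrow> \<alpha> i > 0"
    and d: "\<exists>i\<in>I. d i \<noteq> 0"
  shows "filterlim (\<lambda>k. \<Sum>i\<in>I. d i * real k powr \<alpha> i) at_top sequentially \<or>
         filterlim (\<lambda>k. \<Sum>i\<in>I. d i * real k powr \<alpha> i) at_bot sequentially"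
proof -
  let ?J = "{i \<in> I. d i \<noteq> 0}"
  let ?s = "\<lambda>k. \<Sum>i\<in>I. d i * real k powr \<alpha> i"
  have "finite ?J" "?J \<noteq> {}" using I d by auto
  then obtain j where j: "j \<in> ?J" "\<And>i. i \<in> ?J \<Longrightarrow> \<alpha> i \<le> \<alpha> j"
    using obtains_MAX[of ?J \<alpha>] by (metis (no_types, lifting) Max_ge finite_imageI imageI)
  have "(\<lambda>k. \<Sum>i\<in>I. d i * real k powr (\<alpha> i - \<alpha> j)) \<longlonglongrightarrow> (\<Sum>i\<in>I. if i = j then d j else 0)"
  proof (rule tendsto_sum)
    fix i assume i: "i \<in> I"
    consider "i = j" | "d i = 0" | "i \<noteq> j" "d i \<noteq> 0" by blast
    then show "(\<lambda>k. d i * real k powr (\<alpha> i - \<alpha> j)) \<longlonglongrightarrow> (if i = j then d j else 0)"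
    proof cases
      case 1
      \<comment> \<open>Equality holds only eventually, because \<open>0 powr 0 = 0\<close>.\<close>
      have "\<forall>\<^sub>F k in sequentially. d i * real k powr (\<alpha> i - \<alpha> j) = d j"
        using eventually_gt_at_top[of 0] by eventually_elim (use 1 in auto)
      then show ?thesis using 1 by (simp add: tendsto_eventually)
    next
      case 2
      then show ?thesis using j by auto
    next
      case 3
      then have "\<alpha> i < \<alpha> j" using j i inj by (metis (mono_tags, lifting) inj_on_eq_iff less_eq_real_def mem_Collect_eq)
      then have "(\<lambda>k. d i * real k powr (\<alpha> i - \<alpha> j)) \<longlonglongrightarrow> d i * 0"
        by (intro tendsto_mult tendsto_const tendsto_neg_powr filterlim_real_sequentially) simp
      then show ?thesis using 3 by simp
    qed
  qed
  then have lim: "(\<lambda>k. \<Sum>i\<in>I. d i * real k powr (\<alpha> i - \<alpha> j)) \<longlonglongrightarrow> d j"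
    using j I by simp
  have eq: "(\<Sum>i\<in>I. d i * real k powr (\<alpha> i - \<alpha> j)) * real k powr \<alpha> j = ?s k" for k
    by (cases "k = 0") (auto simp: sum_distrib_right powr_diff)
  have inf: "filterlim (\<lambda>k. real k powr \<alpha> j) at_top sequentially"
    using pos j by (intro filterlim_compose[OF real_powr_at_top filterlim_real_sequentially]) auto
  show ?thesis
  proof (cases "d j > 0")
    case True
    show ?thesis using filterlim_tendsto_pos_mult_at_top[OF lim True inf] by (simp add: eq)
  next
    case False
    then have "d j < 0" using j by auto
    show ?thesis using filterlim_tendsto_neg_mult_at_bot[OF lim \<open>d j < 0\<close> inf] by (simp add: eq)
  qed
qed

text \<open>A maximum taken in the order "the difference tends to plus infinity". This order is
  transitive, since such limits add up, and the hypothesis makes it total on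
  \<open>F\<close>.\<close>

lemma dominant_function_exists:
  fixes h :: "'m \<Rightarrow> nat \<Rightarrow> real"
  assumes "finite F" "F \<noteq> {}"
    and "\<And>m m'. m \<in> F \<Longrightarrow> m' \<in> F \<Longrightarrow> m \<noteq> m' \<Longrightarrow>
      filterlim (\<lambda>k. h m k - h m' k) at_top sequentially \<or>
      filterlim (\<lambda>k. h m k - h m' k) at_bot sequentially"
  shows "\<exists>m\<in>F. \<forall>m'\<in>F - {m}. filterlim (\<lambda>k. h m k - h m' k) at_top sequentially"
  using assms
proof (induction F rule: finite_ne_induct)
  case (singleton m)
  then show ?case by simp
next
  case (insert l F)
  then obtain m where m: "m \<in> F" "\<forall>m'\<in>F - {m}. filterlim (\<lambda>k. h m k - h m' k) at_top sequentially"
    by (metis insertCI)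
  with insert have "l \<noteq> m" by auto
  have "filterlim (\<lambda>k. h m k - h l k) at_top sequentially \<or>
      filterlim (\<lambda>k. h m k - h l k) at_bot sequentially"
    using insert.prems[of m l] m \<open>l \<noteq> m\<close> by auto
  then show ?case
  proof
    assume "filterlim (\<lambda>k. h m k - h l k) at_top sequentially"
    with m show ?thesis by (intro bexI[of _ m]) auto
  next
    assume "filterlim (\<lambda>k. h m k - h l k) at_bot sequentially"
    then have lm: "filterlim (\<lambda>k. h l k - h m k) at_top sequentially"
      by (simp add: filterlim_uminus_at_bot)
    have "filterlim (\<lambda>k. h l k - h m' k) at_top sequentially" if "m' \<in> F" for m'
    proof (cases "m' = m")
      case False
      then have "filterlim (\<lambda>k. (h l k - h m k) + (h m k - h m' k)) at_top sequentially"
        using m that by (intro filterlim_at_top_add_at_top lm) auto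
      then show ?thesis by simp
    qed (simp add: lm)
    then show ?thesis by (intro bexI[of _ l]) auto
  qed
qed

text \<open>Cancellation is excluded by factoring out the dominant exponential
  \<open>exp (h j k)\<close>: the remaining factor tends to the nonzero number
  \<open>a j\<close>.\<close>

lemma exp_sum_divergent:
  fixes h :: "'m \<Rightarrow> nat \<Rightarrow> real"
  assumes F: "finite F" "F \<noteq> {}" and a: "\<And>m. m \<in> F \<Longrightarrow> a m \<noteq> 0"
    and h: "\<And>m. m \<in> F \<Longrightarrow> filterlim (h m) at_top sequentially"
    and sep: "\<And>m m'. m \<in> F \<Longrightarrow> m' \<in> F \<Longrightarrow> m \<noteq> m' \<Longrightarrow>
      filterlim (\<lambda>k. h m k - h m' k) at_top sequentially \<or>
      filterlim (\<lambda>k. h m k - h m' k) at_bot sequentially"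
  shows "filterlim (\<lambda>k. \<bar>\<Sum>m\<in>F. a m * exp (h m k)\<bar>) at_top sequentially"
proof -
  obtain j where j: "j \<in> F" "\<And>m. m \<in> F - {j} \<Longrightarrow> filterlim (\<lambda>k. h j k - h m k) at_top sequentially"
    using dominant_function_exists[OF F, of h] sep by metis
  have "(\<lambda>k. \<Sum>m\<in>F. a m * exp (h m k - h j k)) \<longlonglongrightarrow> (\<Sum>m\<in>F. if m = j then a j else 0)"
  proof (rule tendsto_sum)
    fix m assume m: "m \<in> F"
    show "(\<lambda>k. a m * exp (h m k - h j k)) \<longlonglongrightarrow> (if m = j then a j else 0)"
    proof (cases "m = j")
      case False
      have "filterlim (\<lambda>k. h m k - h j k) at_bot sequentially"
        using j(2)[of m] m False by (simp add: filterlim_uminus_at_bot)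
      then have "(\<lambda>k. a m * exp (h m k - h j k)) \<longlonglongrightarrow> a m * 0"
        by (intro tendsto_mult tendsto_const filterlim_compose[OF exp_at_bot])
      then show ?thesis using False by simp
    qed simp
  qed
  then have "(\<lambda>k. \<bar>\<Sum>m\<in>F. a m * exp (h m k - h j k)\<bar>) \<longlonglongrightarrow> \<bar>a j\<bar>"
    using j F by (auto intro: tendsto_rabs)
  then have "filterlim (\<lambda>k. \<bar>\<Sum>m\<in>F. a m * exp (h m k - h j k)\<bar> * exp (h j k)) at_top sequentially"
    using a[OF j(1)] h[OF j(1)]
    by (intro filterlim_tendsto_pos_mult_at_top filterlim_compose[OF exp_at_top]) auto
  moreover have "\<bar>\<Sum>m\<in>F. a m * exp (h m k - h j k)\<bar> * exp (h j k) = \<bar>\<Sum>m\<in>F. a m * exp (h m k)\<bar>" for k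
  proof -
    have "\<bar>\<Sum>m\<in>F. a m * exp (h m k - h j k)\<bar> * exp (h j k) =
        \<bar>(\<Sum>m\<in>F. a m * exp (h m k - h j k)) * exp (h j k)\<bar>"
      by (simp add: abs_mult)
    then show ?thesis by (simp add: sum_distrib_right mult.assoc exp_diff)
  qed
  ultimately show ?thesis by simp
qed

text \<open>The real-valued counterpart of \<open>mpoly_eval\<close>, to which evaluation in the
  algebra reduces at each index and each point.\<close>

definition mpoly_at :: "real_mpoly \<Rightarrow> (nat \<Rightarrow> real) \<Rightarrow> real" where
  "mpoly_at P c = (\<Sum>m\<in>Poly_Mapping.keys P. Poly_Mapping.lookup P m *
     (\<Prod>i\<in>Poly_Mapping.keys m. c i ^ Poly_Mapping.lookup m i))"

text \<open>On \<open>A\<close> the indicator is 1. Off \<open>A\<close> all variables are 0, and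
  without constant term every monomial contains a variable and vanishes.\<close>

lemma mpoly_at_indicator:
  assumes "Poly_Mapping.lookup P 0 = 0"
  shows "mpoly_at P (\<lambda>i. c i * indicator A y) = mpoly_at P c * indicator A y"
proof (cases "y \<in> A")
  case False
  have "(\<Prod>i\<in>Poly_Mapping.keys m. 0 ^ Poly_Mapping.lookup m i) = (0::real)"
    if "m \<in> Poly_Mapping.keys P" for m
  proof -
    have "m \<noteq> 0" using that assms by (metis in_keys_iff)
    then obtain i where "i \<in> Poly_Mapping.keys m" by (metis all_not_in_conv keys_eq_empty)
    then show ?thesis by (intro prod_zero) (auto simp: in_keys_iff intro!: bexI[of _ i])
  qed
  then have "mpoly_at P (\<lambda>i. 0) = 0"
    unfolding mpoly_at_def by (intro sum.neutral ballI) (simp only: mult_zero_right)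
  with False show ?thesis by simp
qed simp

text \<open>Monomials in exponentials are exponentials of linear forms. Letting all sums run over
  \<open>{..<N}\<close>, with zero exponents filled in, makes different monomials
  comparable.\<close>

lemma mpoly_at_exp:
  assumes "in_vars N P"
  shows "mpoly_at P (\<lambda>i. exp (b i)) =
    (\<Sum>m\<in>Poly_Mapping.keys P. Poly_Mapping.lookup P m *
       exp (\<Sum>i<N. real (Poly_Mapping.lookup m i) * b i))"
  unfolding mpoly_at_def
proof (intro sum.cong refl)
  fix m assume "m \<in> Poly_Mapping.keys P"
  then have sub: "Poly_Mapping.keys m \<subseteq> {..<N}" using assms by (auto simp: in_vars_def)
  have "(\<Prod>i\<in>Poly_Mapping.keys m. exp (b i) ^ Poly_Mapping.lookup m i) =
      (\<Prod>i<N. exp (b i) ^ Poly_Mapping.lookup m i)"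
    using sub by (intro prod.mono_neutral_left) (auto simp: in_keys_iff)
  then show "Poly_Mapping.lookup P m * (\<Prod>i\<in>Poly_Mapping.keys m. exp (b i) ^ Poly_Mapping.lookup m i) =
      Poly_Mapping.lookup P m * exp (\<Sum>i<N. real (Poly_Mapping.lookup m i) * b i)"
    by (simp add: exp_sum exp_of_nat_mult)
qed

text \<open>\<open>exp_sum_divergent\<close> applies to the linear forms that the monomials of
  \<open>P\<close> take in the powers \<open>k powr \<alpha> i\<close>: differences of two such
  forms are handled by \<open>powr_sum_divergent\<close>.\<close>

lemma mpoly_at_exp_powr_divergent:
  assumes P: "P \<noteq> 0" "in_vars N P" "Poly_Mapping.lookup P 0 = 0"
    and inj: "inj_on \<alpha> {..<N}" and pos: "\<And>i. i < N \<Longrightarrow> \<alpha> i > 0"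
  shows "filterlim (\<lambda>k. \<bar>mpoly_at P (\<lambda>i. exp (real k powr \<alpha> i))\<bar>) at_top sequentially"
  unfolding mpoly_at_exp[OF P(2)]
proof (rule exp_sum_divergent)
  have vars: "Poly_Mapping.lookup m i = 0" if "m \<in> Poly_Mapping.keys P" "\<not> i < N" for m i
  proof -
    have "i \<notin> Poly_Mapping.keys m" using that P(2) by (auto simp: in_vars_def)
    then show ?thesis by (simp add: in_keys_iff)
  qed
  show "Poly_Mapping.keys P \<noteq> {}" using P(1) by simp
  fix m assume m: "m \<in> Poly_Mapping.keys P"
  show "Poly_Mapping.lookup P m \<noteq> 0" using m by (simp add: in_keys_iff)
  \<comment> \<open>The missing constant term ensures that each form has a positive coefficient; as
    it is at least 1 and the other terms are nonnegative, the form dominates a single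
    \<open>k powr \<alpha> j\<close>.\<close>
  have "m \<noteq> 0" using m P(3) by (metis in_keys_iff)
  then obtain j where j: "Poly_Mapping.lookup m j \<noteq> 0"
    by (metis lookup_zero poly_mapping_eqI)
  then have jN: "j < N" by (rule contrapos_np) (rule vars[OF m])
  show "filterlim (\<lambda>k. \<Sum>i<N. real (Poly_Mapping.lookup m i) * real k powr \<alpha> i) at_top sequentially"
  proof (rule filterlim_at_top_mono)
    show "filterlim (\<lambda>k. real k powr \<alpha> j) at_top sequentially"
      using pos[OF jN] by (intro filterlim_compose[OF real_powr_at_top filterlim_real_sequentially])
    have "real k powr \<alpha> j \<le> (\<Sum>i<N. real (Poly_Mapping.lookup m i) * real k powr \<alpha> i)" for k
    proof -
      have "real k powr \<alpha> j \<le> real (Poly_Mapping.lookup m j) * real k powr \<alpha> j"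
        using j by (intro mult_le_cancel_right1[THEN iffD2]) auto
      also have "\<dots> \<le> (\<Sum>i<N. real (Poly_Mapping.lookup m i) * real k powr \<alpha> i)"
        using jN by (intro member_le_sum) auto
      finally show ?thesis .
    qed
    then show "\<forall>\<^sub>F k in sequentially.
        real k powr \<alpha> j \<le> (\<Sum>i<N. real (Poly_Mapping.lookup m i) * real k powr \<alpha> i)"
      by simp
  qed
  fix m' assume m': "m' \<in> Poly_Mapping.keys P" and "m \<noteq> m'"
  then obtain l where l: "Poly_Mapping.lookup m l \<noteq> Poly_Mapping.lookup m' l"
    by (metis poly_mapping_eqI)
  then have "l < N" using vars[OF m] vars[OF m'] by metis
  \<comment> \<open>Distinct monomials differ in the exponent of some variable, so these
    coefficients of the difference are not all zero.\<close>
  define d where "d i = real (Poly_Mapping.lookup m i) - real (Poly_Mapping.lookup m' i)" for i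
  have "\<exists>i\<in>{..<N}. d i \<noteq> 0" using l \<open>l < N\<close> by (auto simp: d_def)
  then have "filterlim (\<lambda>k. \<Sum>i<N. d i * real k powr \<alpha> i) at_top sequentially \<or>
         filterlim (\<lambda>k. \<Sum>i<N. d i * real k powr \<alpha> i) at_bot sequentially"
    using inj pos by (intro powr_sum_divergent) auto
  then show "filterlim (\<lambda>k. (\<Sum>i<N. real (Poly_Mapping.lookup m i) * real k powr \<alpha> i) -
        (\<Sum>i<N. real (Poly_Mapping.lookup m' i) * real k powr \<alpha> i)) at_top sequentially \<or>
      filterlim (\<lambda>k. (\<Sum>i<N. real (Poly_Mapping.lookup m i) * real k powr \<alpha> i) -
        (\<Sum>i<N. real (Poly_Mapping.lookup m' i) * real k powr \<alpha> i)) at_bot sequentially"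
    by (simp add: d_def sum_subtractf left_diff_distrib)
qed simp

text \<open>As \<open>\<alpha> i \<le> 1\<close>, every power \<open>k powr \<alpha> i\<close> is at
  most \<open>k\<close>, so all exponents grow at most linearly in \<open>k\<close>.\<close>

lemma mpoly_at_exp_powr_bound:
  assumes P: "in_vars N P" and \<alpha>: "\<And>i. i < N \<Longrightarrow> \<alpha> i \<le> 1"
  obtains C K where "C > 0" "\<And>k. \<bar>mpoly_at P (\<lambda>i. exp (real k powr \<alpha> i))\<bar> \<le> C * exp (K * real k)"
proof
  \<comment> \<open>Summing over all monomials gives one \<open>K\<close> above the total degree of
    each of them. The summand 1 in \<open>C\<close> keeps \<open>C\<close> positive also for
    \<open>P = 0\<close>.\<close>
  define K where "K = (\<Sum>m\<in>Poly_Mapping.keys P. \<Sum>i<N. real (Poly_Mapping.lookup m i))"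
  define C where "C = 1 + (\<Sum>m\<in>Poly_Mapping.keys P. \<bar>Poly_Mapping.lookup P m\<bar>)"
  show "C > 0" unfolding C_def by (simp add: add_pos_nonneg sum_nonneg)
  fix k :: nat
  have powr_le: "real k powr \<alpha> i \<le> real k" if "i < N" for i
    using powr_mono[OF \<alpha>[OF that], of "real k"] by (cases "k = 0") auto
  have "(\<Sum>i<N. real (Poly_Mapping.lookup m i) * real k powr \<alpha> i) \<le> K * real k"
    if m: "m \<in> Poly_Mapping.keys P" for m
  proof -
    have "(\<Sum>i<N. real (Poly_Mapping.lookup m i) * real k powr \<alpha> i) \<le>
        (\<Sum>i<N. real (Poly_Mapping.lookup m i) * real k)"
      using powr_le by (intro sum_mono mult_left_mono) auto
    also have "\<dots> = (\<Sum>i<N. real (Poly_Mapping.lookup m i)) * real k"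
      by (simp add: sum_distrib_right)
    also have "\<dots> \<le> K * real k"
      unfolding K_def using m by (intro mult_right_mono member_le_sum) (auto intro: sum_nonneg)
    finally show ?thesis .
  qed
  then have "\<bar>mpoly_at P (\<lambda>i. exp (real k powr \<alpha> i))\<bar> \<le>
      (\<Sum>m\<in>Poly_Mapping.keys P. \<bar>Poly_Mapping.lookup P m\<bar> * exp (K * real k))"
    unfolding mpoly_at_exp[OF P]
    by (intro sum_norm_le[where 'a = real, unfolded real_norm_def])
       (auto simp: abs_mult intro!: mult_left_mono)
  also have "\<dots> \<le> C * exp (K * real k)"
    unfolding C_def by (simp add: sum_distrib_right[symmetric] distrib_right)
  finally show "\<bar>mpoly_at P (\<lambda>i. exp (real k powr \<alpha> i))\<bar> \<le> C * exp (K * real k)" .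
qed

section \<open>Polynomials of sequences of classes\<close>

lemma seq_class_closed: "(\<And>n. f n \<in> borel_measurable M) \<Longrightarrow> seq_class M f \<in> carrier (L0_seq M)"
  by (simp add: seq_algebra_def seq_class_def ae_class_in_carrier)

context
  fixes M :: "'a measure" and f :: "nat \<Rightarrow> 'a \<Rightarrow> real"
  assumes f: "\<And>n. f n \<in> borel_measurable M"
begin

lemma seq_class_add:
  "(\<And>n. g n \<in> borel_measurable M) \<Longrightarrow>
    seq_class M f \<oplus>\<^bsub>L0_seq M\<^esub> seq_class M g = seq_class M (\<lambda>n x. f n x + g n x)"
  by (simp add: seq_algebra_def seq_class_def L0_add_class f)

lemma seq_class_mult:
  "(\<And>n. g n \<in> borel_measurable M) \<Longrightarrow>
    seq_class M f \<otimes>\<^bsub>L0_seq M\<^esub> seq_class M g = seq_class M (\<lambda>n x. f n x * g n x)"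
  by (simp add: seq_algebra_def seq_class_def L0_mult_class f)

lemma seq_class_smult:
  "c \<odot>\<^bsub>L0_seq M\<^esub> seq_class M f = seq_class M (\<lambda>n x. c * f n x)"
  by (simp add: seq_algebra_def seq_class_def L0_smult_class f)

end

lemma seq_class_zero: "\<zero>\<^bsub>L0_seq M\<^esub> = seq_class M (\<lambda>n x. 0)"
  and seq_class_one: "\<one>\<^bsub>L0_seq M\<^esub> = seq_class M (\<lambda>n x. 1)"
  by (simp_all add: seq_algebra_def seq_class_def L0_zero L0_one)

lemma L0_seq_algebra: "Module.algebra real_ring (L0_seq M)"
  by (intro seq_algebra_algebra L0_algebra)

lemma seq_class_power:
  assumes "\<And>n. f n \<in> borel_measurable M"
  shows "seq_class M f [^]\<^bsub>L0_seq M\<^esub> (j::nat) = seq_class M (\<lambda>n x. f n x ^ j)"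
proof -
  interpret Module.algebra real_ring "L0_seq M" by (rule L0_seq_algebra)
  show ?thesis
    by (induction j) (simp_all add: seq_class_one seq_class_mult assms borel_measurable_power mult.commute)
qed

lemma seq_class_finprod:
  assumes "finite I" and "\<And>i n. f i n \<in> borel_measurable M"
  shows "finprod (L0_seq M) (\<lambda>i. seq_class M (f i)) I = seq_class M (\<lambda>n x. \<Prod>i\<in>I. f i n x)"
proof -
  interpret Module.algebra real_ring "L0_seq M" by (rule L0_seq_algebra)
  show ?thesis
    using assms(1)
    by (induction I)
       (simp_all add: seq_class_one seq_class_mult seq_class_closed assms(2) borel_measurable_prod)
qed

lemma seq_class_finsum:
  assumes "finite I" and "\<And>i n. f i n \<in> borel_measurable M"
  shows "finsum (L0_seq M) (\<lambda>i. seq_class M (f i)) I = seq_class M (\<lambda>n x. \<Sum>i\<in>I. f i n x)"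
proof -
  interpret Module.algebra real_ring "L0_seq M" by (rule L0_seq_algebra)
  show ?thesis
    using assms(1)
    by (induction I)
       (simp_all add: seq_class_zero seq_class_add seq_class_closed assms(2) borel_measurable_sum)
qed

text \<open>Transfers evaluation in the quotient algebra to pointwise evaluation of representatives.
  Knowing \<open>x i\<close> for \<open>i < N\<close> is enough, because \<open>P\<close> involves
  only these variables.\<close>

lemma mpoly_eval_seq_class:
  assumes P: "in_vars N P" and x: "\<And>i. i < N \<Longrightarrow> x i = seq_class M (f i)"
    and f: "\<And>i n. f i n \<in> borel_measurable M"
  shows "mpoly_eval (L0_seq M) P x = seq_class M (\<lambda>n y. mpoly_at P (\<lambda>i. f i n y))"
proof -
  interpret Module.algebra real_ring "L0_seq M" by (rule L0_seq_algebra)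
  note [measurable] = f
  have "finprod (L0_seq M) (\<lambda>i. x i [^]\<^bsub>L0_seq M\<^esub> Poly_Mapping.lookup m i) (Poly_Mapping.keys m) =
      seq_class M (\<lambda>n y. \<Prod>i\<in>Poly_Mapping.keys m. f i n y ^ Poly_Mapping.lookup m i)"
    if m: "m \<in> Poly_Mapping.keys P" for m
  proof -
    have "finprod (L0_seq M) (\<lambda>i. x i [^]\<^bsub>L0_seq M\<^esub> Poly_Mapping.lookup m i) (Poly_Mapping.keys m) =
      finprod (L0_seq M) (\<lambda>i. seq_class M (\<lambda>n y. f i n y ^ Poly_Mapping.lookup m i)) (Poly_Mapping.keys m)"
    proof (rule finprod_cong')
      fix i assume "i \<in> Poly_Mapping.keys m"
      then have "i < N" using P m by (auto simp: in_vars_def)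
      then show "x i [^]\<^bsub>L0_seq M\<^esub> Poly_Mapping.lookup m i =
          seq_class M (\<lambda>n y. f i n y ^ Poly_Mapping.lookup m i)"
        by (simp add: x seq_class_power f)
    qed (auto intro!: seq_class_closed)
    then show ?thesis by (simp add: seq_class_finprod)
  qed
  then have "mpoly_eval (L0_seq M) P x = finsum (L0_seq M)
     (\<lambda>m. seq_class M (\<lambda>n y. Poly_Mapping.lookup P m *
        (\<Prod>i\<in>Poly_Mapping.keys m. f i n y ^ Poly_Mapping.lookup m i))) (Poly_Mapping.keys P)"
    unfolding mpoly_eval_def
    \<comment> \<open>\<open>finsum\<close> is \<open>finprod\<close> in the additive
      monoid.\<close>
    by (intro add.finprod_cong') (auto intro!: seq_class_closed simp: seq_class_smult)
  then show ?thesis by (simp add: seq_class_finsum mpoly_at_def)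
qed

section \<open>Comparison of the modes of convergence\<close>

lemma strongly_c_algebrable_mono:
  "strongly_c_algebrable A S \<Longrightarrow> S \<subseteq> T \<Longrightarrow> strongly_c_algebrable A T"
  unfolding strongly_c_algebrable_def by (elim exE conjE, intro exI conjI) blast+

text \<open>Markov's inequality for \<open>\<bar>f n x\<bar> powr q\<close>, with the constant
  \<open>inverse (\<epsilon> powr q)\<close>.\<close>

lemma S_L_subset_S_m:
  assumes "q > 0"
  shows "S_L M q \<subseteq> S_m M"
proof
  fix F assume "F \<in> S_L M q"
  then obtain f where F: "F = seq_class M f" and f: "\<And>n. f n \<in> borel_measurable M"
    and lim: "(\<lambda>n. \<integral>\<^sup>+ x. ennreal (\<bar>f n x\<bar> powr q) \<partial>M) \<longlonglongrightarrow> 0"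
    unfolding S_L_def by auto
  note [measurable] = f
  have "(\<lambda>n. emeasure M {x \<in> space M. \<bar>f n x\<bar> > \<epsilon>}) \<longlonglongrightarrow> 0" if "\<epsilon> > 0" for \<epsilon> :: real
  proof (rule tendsto_sandwich[OF _ _ tendsto_const])
    let ?c = "ennreal (inverse (\<epsilon> powr q))"
    have "emeasure M {x \<in> space M. \<bar>f n x\<bar> > \<epsilon>} \<le> ?c * (\<integral>\<^sup>+ x. ennreal (\<bar>f n x\<bar> powr q) \<partial>M)" for n
    proof -
      have "emeasure M {x \<in> space M. \<bar>f n x\<bar> > \<epsilon>} \<le>
          emeasure M {x \<in> space M. 1 \<le> ?c * ennreal (\<bar>f n x\<bar> powr q)}"
      proof (intro emeasure_mono subsetI)
        fix x assume x: "x \<in> {x \<in> space M. \<bar>f n x\<bar> > \<epsilon>}"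
        then have "\<epsilon> powr q \<le> \<bar>f n x\<bar> powr q"
          using \<open>\<epsilon> > 0\<close> \<open>q > 0\<close> by (intro powr_mono2) auto
        then have "1 \<le> inverse (\<epsilon> powr q) * \<bar>f n x\<bar> powr q"
          using \<open>\<epsilon> > 0\<close> by (simp add: field_simps)
        then show "x \<in> {x \<in> space M. 1 \<le> ?c * ennreal (\<bar>f n x\<bar> powr q)}"
          using x by (simp add: ennreal_mult[symmetric])
      qed measurable
      also have "\<dots> \<le> ?c * (\<integral>\<^sup>+ x. ennreal (\<bar>f n x\<bar> powr q) * indicator (space M) x \<partial>M)"
        by (rule nn_integral_Markov_inequality) measurable
      also have "(\<integral>\<^sup>+ x. ennreal (\<bar>f n x\<bar> powr q) * indicator (space M) x \<partial>M) =
          (\<integral>\<^sup>+ x. ennreal (\<bar>f n x\<bar> powr q) \<partial>M)"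
        by (intro nn_integral_cong) simp
      finally show ?thesis .
    qed
    then show "\<forall>\<^sub>F n in sequentially. emeasure M {x \<in> space M. \<bar>f n x\<bar> > \<epsilon>} \<le>
        ?c * (\<integral>\<^sup>+ x. ennreal (\<bar>f n x\<bar> powr q) \<partial>M)"
      by simp
    show "(\<lambda>n. ?c * (\<integral>\<^sup>+ x. ennreal (\<bar>f n x\<bar> powr q) \<partial>M)) \<longlonglongrightarrow> 0"
      using ennreal_tendsto_cmult[OF _ lim, of ?c] by simp
  qed simp
  then show "F \<in> S_m M" unfolding F S_m_iff[OF f] by blast
qed

text \<open>Borel-Cantelli at each threshold \<open>1 / Suc j\<close>; the countably many
  exceptional null sets are then combined.\<close>

lemma S_c_subset_S_p: "S_c M \<subseteq> S_p M"
proof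
  fix F assume "F \<in> S_c M"
  then obtain f where F: "F = seq_class M f" and f: "\<And>n. f n \<in> borel_measurable M"
    and sum: "\<And>\<epsilon>::real. \<epsilon> > 0 \<Longrightarrow> suminf (\<lambda>n. emeasure M {x \<in> space M. \<bar>f n x\<bar> > \<epsilon>}) < \<infinity>"
    unfolding S_c_def by auto
  note [measurable] = f
  have "AE x in M. \<forall>\<^sub>F n in sequentially. \<bar>f n x\<bar> \<le> 1 / real (Suc j)" for j
  proof -
    let ?A = "\<lambda>n. {x \<in> space M. \<bar>f n x\<bar> > 1 / real (Suc j)}"
    have s: "suminf (\<lambda>n. emeasure M (?A n)) < \<infinity>" by (rule sum) simp
    \<comment> \<open>Finiteness of each term turns the extended series into the summable real
      series that Borel-Cantelli expects.\<close>
    have fin: "emeasure M (?A n) \<noteq> \<infinity>" for n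
    proof -
      have "emeasure M (?A n) \<le> suminf (\<lambda>n. emeasure M (?A n))"
        using sum_le_suminf[of "\<lambda>n. emeasure M (?A n)" "{n}"] by simp
      with s show ?thesis using order_le_less_trans by fastforce
    qed
    have "summable (\<lambda>n. measure M (?A n))"
      using s fin by (intro summable_suminf_not_top) (auto simp: emeasure_eq_ennreal_measure)
    then have "AE x in M. \<forall>\<^sub>F n in sequentially. x \<in> space M - ?A n"
      using fin by (intro borel_cantelli_AE1) (auto simp: less_top)
    then show ?thesis
      by eventually_elim (auto elim!: eventually_mono)
  qed
  then have "AE x in M. \<forall>j. \<forall>\<^sub>F n in sequentially. \<bar>f n x\<bar> \<le> 1 / real (Suc j)"
    by (simp add: AE_all_countable)
  then have "AE x in M. (\<lambda>n. f n x) \<longlonglongrightarrow> 0"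
  proof eventually_elim
    fix x assume *: "\<forall>j. \<forall>\<^sub>F n in sequentially. \<bar>f n x\<bar> \<le> 1 / real (Suc j)"
    show "(\<lambda>n. f n x) \<longlonglongrightarrow> 0"
    proof (rule tendstoI)
      fix e :: real assume "e > 0"
      then obtain j where j: "1 / real (Suc j) < e" using nat_approx_posE by metis
      from *[rule_format, of j] show "\<forall>\<^sub>F n in sequentially. dist (f n x) 0 < e"
        by eventually_elim (use j in auto)
    qed
  qed
  then show "F \<in> S_p M" unfolding F S_p_iff[OF f] .
qed

lemma S_u_subset_S_au: "S_u M \<subseteq> S_au M"
proof
  fix F assume "F \<in> S_u M"
  then obtain f Z where "F = seq_class M f" and f: "\<And>n. f n \<in> borel_measurable M"
    and "Z \<in> sets M" "emeasure M Z = 0" "uniform_limit (space M - Z) f (\<lambda>x. 0) sequentially"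
    unfolding S_u_def by auto
  then show "F \<in> S_au M"
    by (auto simp: S_au_iff[OF f] intro!: bexI[of _ Z])
qed

text \<open>The exceptional sets for \<open>1 / Suc j\<close> have a null intersection, and a point
  outside it avoids some \<open>Z j\<close>, off which convergence is uniform.\<close>

lemma S_au_subset_S_p: "S_au M \<subseteq> S_p M"
proof
  fix F assume "F \<in> S_au M"
  then obtain f where F: "F = seq_class M f" and f: "\<And>n. f n \<in> borel_measurable M"
    and Z: "\<And>\<epsilon>::real. \<epsilon> > 0 \<Longrightarrow> \<exists>Z\<in>sets M. emeasure M Z < ennreal \<epsilon> \<and>
        uniform_limit (space M - Z) f (\<lambda>x. 0) sequentially"
    unfolding S_au_def by auto
  have "\<exists>Z\<in>sets M. emeasure M Z < ennreal (1 / real (Suc j)) \<and>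
        uniform_limit (space M - Z) f (\<lambda>x. 0) sequentially" for j
    by (rule Z) simp
  then obtain Z where Zs: "\<And>j. Z j \<in> sets M" "\<And>j. emeasure M (Z j) < ennreal (1 / real (Suc j))"
    "\<And>j. uniform_limit (space M - Z j) f (\<lambda>x. 0) sequentially" by metis
  have "emeasure M (\<Inter>j. Z j) \<le> ennreal e" if e: "e > 0" for e
  proof -
    obtain j where "1 / real (Suc j) < e" using nat_approx_posE[OF e] by metis
    then have "ennreal (1 / real (Suc j)) \<le> ennreal e" by (intro ennreal_leI) simp
    moreover have "emeasure M (\<Inter>j. Z j) \<le> emeasure M (Z j)"
      using Zs(1) by (intro emeasure_mono) auto
    ultimately show ?thesis using Zs(2)[of j] by (meson less_imp_le order_trans)
  qed
  then have "emeasure M (\<Inter>j. Z j) \<le> 0"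
    by - (rule ennreal_le_epsilon, simp only: add_0)
  then have "(\<Inter>j. Z j) \<in> null_sets M" using Zs(1) by (intro null_setsI sets.countable_INT) auto
  then have "AE x in M. x \<notin> (\<Inter>j. Z j)" by (rule AE_not_in)
  then have "AE x in M. (\<lambda>n. f n x) \<longlonglongrightarrow> 0"
    using AE_space
  proof eventually_elim
    case (elim x)
    then obtain j where "x \<in> space M - Z j" by auto
    then show ?case using tendsto_uniform_limitI[OF Zs(3)] by blast
  qed
  then show "F \<in> S_p M" unfolding F S_p_iff[OF f] .
qed

section \<open>Strong algebrability\<close>

lemma nonatomic_L_not_pointwise:
  assumes E: "E \<in> fmeasurable M" "measure M E > 0" and na: "nonatomic M"
  shows "strongly_c_algebrable (L0_seq M) ((\<Inter>q\<in>{0<..}. S_L M q) - S_p M)"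
proof -
  have "E \<noteq> {}" using E(2) by auto
  then obtain A k where A: "\<And>n. A n \<in> fmeasurable M" "\<And>n. measure M (A n) \<le> exp (- (real (k n))\<^sup>2)"
    and k: "filterlim k at_top sequentially"
    and EA: "\<And>x. x \<in> E \<Longrightarrow> \<exists>\<^sub>F n in sequentially. x \<in> A n"
    using nonatomic_typewriter[OF na E(1), of "\<lambda>k. exp (- (real k)\<^sup>2)"] by auto
  have [measurable]: "A n \<in> sets M" for n using A(1) by (rule fmeasurableD)
  \<comment> \<open>Both the distinctness of the generators and the failure of pointwise convergence
    are proved by contradicting this.\<close>
  have not_AE: "\<not> (AE x in M. x \<notin> E)"
  proof
    assume "AE x in M. x \<notin> E"
    then have "E \<in> null_sets M" using E(1) by (simp add: AE_iff_null_sets fmeasurableD)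
    then show False using E by (simp add: null_sets_def measure_def)
  qed
  define c where "c \<alpha> n = exp (real (k n) powr \<alpha>)" for \<alpha> n
  define f where "f \<alpha> n y = c \<alpha> n * indicator (A n) y" for \<alpha> n y
  have f[measurable]: "f \<alpha> n \<in> borel_measurable M" for \<alpha> n
    unfolding f_def by measurable
  define X where "X \<alpha> = seq_class M (f \<alpha>)" for \<alpha>
  have "inj_on X {0<..<1}"
  proof
    fix \<alpha> \<beta> :: real assume "\<alpha> \<in> {0<..<1}" "\<beta> \<in> {0<..<1}" and "X \<alpha> = X \<beta>"
    show "\<alpha> = \<beta>"
    proof (rule ccontr)
      assume "\<alpha> \<noteq> \<beta>"
      have "AE x in M. \<forall>n. f \<alpha> n x = f \<beta> n x"
        using seq_class_eqD[of M "f \<alpha>" "f \<beta>", OF _ f f] \<open>X \<alpha> = X \<beta>\<close> by (simp add: X_def)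
      then have "AE x in M. x \<notin> E"
      proof eventually_elim
        case (elim x)
        \<comment> \<open>The bases 0 and 1 are avoided, since their powers do not depend on the
          positive exponent.\<close>
        have "\<forall>\<^sub>F n in sequentially. k n \<ge> 2" using k by (auto simp: filterlim_at_top)
        then have "\<forall>\<^sub>F n in sequentially. x \<notin> A n"
        proof eventually_elim
          fix n assume "2 \<le> k n"
          then have "c \<alpha> n \<noteq> c \<beta> n"
            using \<open>\<alpha> \<noteq> \<beta>\<close> powr_inj[of "real (k n)" \<alpha> \<beta>] by (auto simp: c_def)
          then show "x \<notin> A n" using elim[rule_format, of n] by (auto simp: f_def)
        qed
        then show "x \<notin> E" using EA[of x] by (auto simp: frequently_def)
      qed
      then show False using not_AE by simp
    qed
  qed
  then have card: "X ` {0<..<1} \<approx> (UNIV :: real set)"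
    using open_interval_eqpoll_reals[of 0 1] by (simp add: inj_on_image_eqpoll_1)
  show ?thesis
    unfolding strongly_c_algebrable_def
  proof (intro exI[of _ "X ` {0<..<1}"] conjI card allI impI)
    show "X ` {0<..<1} \<subseteq> carrier (L0_seq M)"
      unfolding X_def using f by (auto intro!: seq_class_closed)
    fix N P x
    assume *: "N > 0 \<and> P \<noteq> 0 \<and> in_vars N P \<and> Poly_Mapping.lookup P 0 = 0 \<and>
             x ` {..<N} \<subseteq> X ` {0<..<1} \<and> inj_on x {..<N}"
    then have "\<forall>i\<in>{..<N}. \<exists>\<alpha>. \<alpha> \<in> {0<..<1} \<and> x i = X \<alpha>" by blast
    then obtain \<alpha> where \<alpha>: "\<And>i. i < N \<Longrightarrow> \<alpha> i \<in> {0<..<1}" "\<And>i. i < N \<Longrightarrow> x i = X (\<alpha> i)"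
      unfolding bchoice_iff by auto
    have inj: "inj_on \<alpha> {..<N}"
      using * \<alpha>(2) by (metis (mono_tags, lifting) inj_on_def lessThan_iff)
    define p where "p j = mpoly_at P (\<lambda>i. exp (real j powr \<alpha> i))" for j :: nat
    \<comment> \<open>The generators share the supports \<open>A n\<close>, so a polynomial in them
      is again a multiple of the indicator of \<open>A n\<close>, with a factor that depends on
      \<open>n\<close> only through the level.\<close>
    define h where "h n y = p (k n) * indicator (A n) y" for n y
    have h[measurable]: "h n \<in> borel_measurable M" for n unfolding h_def by measurable
    have "mpoly_eval (L0_seq M) P x = seq_class M (\<lambda>n y. mpoly_at P (\<lambda>i. f (\<alpha> i) n y))"
      using * \<alpha>(2) by (intro mpoly_eval_seq_class[of N]) (auto simp: X_def)
    also have "\<dots> = seq_class M h"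
      using * by (simp add: f_def c_def h_def[abs_def] p_def mpoly_at_indicator)
    finally have eval: "mpoly_eval (L0_seq M) P x = seq_class M h" .
    have p_top: "filterlim (\<lambda>j. \<bar>p j\<bar>) at_top sequentially"
      unfolding p_def using * \<alpha>(1) by (intro mpoly_at_exp_powr_divergent[OF _ _ _ inj]) auto
    obtain C K where C: "C > 0" "\<And>j. \<bar>p j\<bar> \<le> C * exp (K * real j)"
      using mpoly_at_exp_powr_bound[of N P \<alpha>] * \<alpha>(1) unfolding p_def
      by (metis greaterThanLessThan_iff less_imp_le)
    have "seq_class M h \<in> S_L M q" if q: "q > 0" for q
      unfolding S_L_iff[OF h]
    proof (rule tendsto_sandwich[OF _ _ tendsto_const])
      \<comment> \<open>The \<open>q\<close>-th power of the bound on
        \<open>\<bar>p j\<bar>\<close>, times the bound \<open>exp (- j^2)\<close> on the measure of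
        a set of level \<open>j\<close>.\<close>
      let ?u = "\<lambda>j. C powr q * exp (q * K * real j - (real j)\<^sup>2)"
      have "(\<integral>\<^sup>+ y. ennreal (\<bar>h n y\<bar> powr q) \<partial>M) \<le> ennreal (?u (k n))" for n
      proof -
        have "(\<integral>\<^sup>+ y. ennreal (\<bar>h n y\<bar> powr q) \<partial>M) =
            (\<integral>\<^sup>+ y. ennreal (\<bar>p (k n)\<bar> powr q) * indicator (A n) y \<partial>M)"
          using q by (intro nn_integral_cong) (auto simp: h_def indicator_def)
        also have "\<dots> = ennreal (\<bar>p (k n)\<bar> powr q) * ennreal (measure M (A n))"
          by (simp add: nn_integral_cmult_indicator emeasure_eq_measure2[OF A(1)])
        also have "\<dots> = ennreal (\<bar>p (k n)\<bar> powr q * measure M (A n))"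
          by (simp add: ennreal_mult)
        also have "\<dots> \<le> ennreal ((C * exp (K * real (k n))) powr q * exp (- (real (k n))\<^sup>2))"
          using C q A(2) by (intro ennreal_leI mult_mono powr_mono2) auto
        also have "(C * exp (K * real (k n))) powr q * exp (- (real (k n))\<^sup>2) = ?u (k n)"
          using C(1) by (simp add: powr_mult exp_powr_real exp_diff exp_minus field_simps)
        finally show ?thesis .
      qed
      then show "\<forall>\<^sub>F n in sequentially. (\<integral>\<^sup>+ y. ennreal (\<bar>h n y\<bar> powr q) \<partial>M) \<le> ennreal (?u (k n))"
        by simp
      \<comment> \<open>This product is the negated exponent in \<open>?u\<close>; both factors tend
        to infinity, whatever \<open>q\<close> and \<open>K\<close> are.\<close>
      have "filterlim (\<lambda>j. real j * (real j - q * K)) at_top sequentially"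
        by (intro filterlim_at_top_mult_at_top filterlim_real_sequentially)
           (use filterlim_tendsto_add_at_top[OF tendsto_const[of "- (q * K)"] filterlim_real_sequentially] in simp)
      then have "filterlim (\<lambda>j. q * K * real j - (real j)\<^sup>2) at_bot sequentially"
        unfolding filterlim_uminus_at_bot by (simp add: algebra_simps power2_eq_square)
      then have "?u \<longlonglongrightarrow> C powr q * 0"
        by (intro tendsto_mult tendsto_const filterlim_compose[OF exp_at_bot])
      then have "(\<lambda>n. ?u (k n)) \<longlonglongrightarrow> 0"
        using filterlim_compose[OF _ k, of ?u] by simp
      then show "(\<lambda>n. ennreal (?u (k n))) \<longlonglongrightarrow> 0"
        using tendsto_ennrealI by fastforce
    qed simp
    moreover have not_p: "seq_class M h \<notin> S_p M"
    proof
      assume "seq_class M h \<in> S_p M"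
      then have "AE x in M. (\<lambda>n. h n x) \<longlonglongrightarrow> 0" by (simp only: S_p_iff[OF h])
      then have "AE x in M. x \<notin> E"
      proof eventually_elim
        case (elim y)
        \<comment> \<open>On \<open>A n\<close> the value \<open>\<bar>h n y\<bar>\<close> equals
          \<open>\<bar>p (k n)\<bar>\<close>, which is eventually at least 1. So \<open>y\<close>
          eventually leaves the sets \<open>A n\<close>, which no point of \<open>E\<close>
          does.\<close>
        have "\<forall>\<^sub>F n in sequentially. \<bar>h n y\<bar> < 1"
          using tendsto_rabs_zero[OF elim] by (rule order_tendstoD) simp
        moreover have "\<forall>\<^sub>F n in sequentially. 1 \<le> \<bar>p (k n)\<bar>"
          using filterlim_compose[OF p_top k] by (auto simp: filterlim_at_top)
        ultimately have "\<forall>\<^sub>F n in sequentially. y \<notin> A n"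
          by eventually_elim (auto simp: h_def indicator_def split: if_splits)
        then show "y \<notin> E" using EA[of y] by (auto simp: frequently_def)
      qed
      then show False using not_AE by simp
    qed
    \<comment> \<open>Lying outside \<open>S_p M\<close> therefore already rules out the zero
      element.\<close>
    moreover have "\<zero>\<^bsub>L0_seq M\<^esub> \<in> S_p M"
      unfolding seq_class_zero by (subst S_p_iff) auto
    ultimately show "mpoly_eval (L0_seq M) P x \<in>
        (\<Inter>q\<in>{0<..}. S_L M q) - S_p M - {\<zero>\<^bsub>L0_seq M\<^esub>}"
      unfolding eval by auto
  qed
qed

theorem theorem4p1:
  fixes M :: "'a measure"
  assumes "emeasure M (space M) > 0"
    and "nonatomic M"
    and "semifinite M"
  shows "strongly_c_algebrable (L0_seq M) ((\<Inter>q\<in>{0<..}. S_L M q) - S_p M) \<and>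
         strongly_c_algebrable (L0_seq M) (S_m M - S_p M) \<and>
         strongly_c_algebrable (L0_seq M) (S_m M - S_c M) \<and>
         strongly_c_algebrable (L0_seq M) (S_m M - S_au M) \<and>
         strongly_c_algebrable (L0_seq M) (S_m M - S_u M)"
proof -
  obtain E where "E \<in> fmeasurable M" "measure M E > 0"
    using semifinite_obtains[OF assms(3) sets.top assms(1)] by metis
  then have L: "strongly_c_algebrable (L0_seq M) ((\<Inter>q\<in>{0<..}. S_L M q) - S_p M)"
    using assms(2) by (rule nonatomic_L_not_pointwise)
  \<comment> \<open>The single exponent \<open>q = 1\<close> gives this inclusion. Since
    \<open>S_c M\<close>, \<open>S_au M\<close> and \<open>S_u M\<close> lie inside
    \<open>S_p M\<close>, each of the four differences contains the first set, and the same
    generators serve for all.\<close>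
  have "(\<Inter>q\<in>{0<..}. S_L M q) \<subseteq> S_m M"
    using S_L_subset_S_m[of 1 M] by force
  then show ?thesis
    using S_c_subset_S_p[of M] S_u_subset_S_au[of M] S_au_subset_S_p[of M]
    by (intro conjI L strongly_c_algebrable_mono[OF L]) blast+
qed

end
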